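(* $\lambda_3(n)\ge 2n\,\alpha(n)-O(n)$ for all $n$.
   Context: A Davenport--Schinzel sequence of order $s$ is a finite sequence with no two adjacent equal entries and containing no (not necessarily contiguous) subsequence $a\,b\,a\,b\ldots$ of length $s+2$ with $a\ne b$. $\lambda_s(n)$ is the maximum length of such a sequence on $n$ distinct symbols. The inverse Ackermann hierarchy: $\alpha_1(x)=\lceil x/2\rceil$; for $k\ge2$, $\alpha_k(x)=0$ if $x\le1$ and $\alpha_k(x)=1+\alpha_k(\alpha_{k-1}(x))$ otherwise. The inverse Ackermann function is $\alpha(x)=\min\{k\mid\alpha_k(x)\le3\}$. *)

theory Defs
  imports Complex_Main "HOL-Library.Sublist"
begin

definition alternation :: "'a \<Rightarrow> 'a \<Rightarrow> nat \<Rightarrow> 'a list" where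
  "alternation a b m = map (\<lambda>i. if even i then a else b) [0..<m]"

definition davenport_schinzel :: "nat \<Rightarrow> 'a list \<Rightarrow> bool" where
  "davenport_schinzel s u \<longleftrightarrow>
     distinct_adj u \<and> \<not> (\<exists>a b. a \<noteq> b \<and> subseq (alternation a b (s + 2)) u)"

lemma alternation_add_2: "alternation a b (Suc (Suc m)) = a # b # alternation a b m"
proof -
  have "[0..<Suc (Suc m)] = 0 # 1 # map (\<lambda>i. Suc (Suc i)) [0..<m]"
    by (simp add: upt_conv_Cons map_Suc_upt flip: map_map[unfolded comp_def, of Suc Suc] del: upt_Suc)
  then show ?thesis by (simp add: alternation_def del: upt_Suc)
qed

lemma subseq_alternation_mono:
  assumes "m \<le> m'" shows "subseq (alternation a b m) (alternation a b m')"
proof -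
  have "[0..<m'] = [0..<m] @ [m..<m']"
    using assms by (metis le_add_diff_inverse upt_add_eq_append zero_le)
  then show ?thesis
    by (metis alternation_def map_append prefixI prefix_imp_subseq)
qed

lemma subseq_alternation_adjacent_pairs:
  assumes "a \<noteq> b"
  shows "subseq (alternation a b (2 * count_list (zip u (tl u)) (a, b))) u"
proof (induction u rule: length_induct)
  case (1 u)
  consider "length u \<le> 1" | x y v where "u = x # y # v"
    by (cases u rule: list.exhaust; cases "tl u") auto
  then show ?case
  proof cases
    case 1
    then show ?thesis by (cases u) (auto simp: alternation_def)
  next
    case (2 x y v)
    show ?thesis
    proof (cases "x = a \<and> y = b")
      case True
      have "count_list (zip (y # v) v) (a, b) = count_list (zip v (tl v)) (a, b)"
        using True assms by (cases v) auto
      moreover have "subseq (alternation a b (2 * count_list (zip v (tl v)) (a, b))) v"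
        using "1.IH" 2 by simp
      ultimately show ?thesis using True by (simp add: 2 alternation_add_2)
    next
      case False
      moreover have "subseq (alternation a b (2 * count_list (zip (y # v) (tl (y # v))) (a, b))) (y # v)"
        using "1.IH" 2 by (metis length_Cons lessI)
      ultimately show ?thesis by (auto simp: 2 intro: list_emb_Cons)
    qed
  qed
qed

lemma davenport_schinzel_length_le:
  assumes "davenport_schinzel s u"
  shows "length u \<le> 1 + (s + 1) * card (set u) ^ 2"
proof -
  let ?ps = "zip u (tl u)"
  have count: "count_list ?ps (a, b) \<le> s + 1" for a b
  proof (cases "a = b")
    case True
    have "(a, a) \<notin> set ?ps"
      using assms
      by (force simp: davenport_schinzel_def set_zip nth_tl distinct_adj_conv_nth)
    then show ?thesis using True by (simp add: count_list_0_iff)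
  next
    case False
    show ?thesis
    proof (rule ccontr)
      assume "\<not> ?thesis"
      then have "subseq (alternation a b (s + 2)) u"
        using subseq_alternation_mono[of "s + 2" "2 * count_list ?ps (a, b)" a b]
          subseq_alternation_adjacent_pairs[OF False, of u] subseq_order.trans by fastforce
      then show False using assms False by (auto simp: davenport_schinzel_def)
    qed
  qed
  have "set ?ps \<subseteq> set u \<times> set u"
    by (auto dest: set_zip_leftD set_zip_rightD list.set_sel(2)[rotated])
       (metis list.sel(2) list.set_sel(2) set_zip_rightD)
  then have "length ?ps = (\<Sum>p\<in>set u \<times> set u. count_list ?ps p)"
    by (simp add: sum_count_set)
  also have "\<dots> \<le> card (set u \<times> set u) * (s + 1)"
    using sum_bounded_above[of "set u \<times> set u" "count_list ?ps" "s + 1"] count by auto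
  finally show ?thesis
    by (simp add: card_cartesian_product power2_eq_square mult.commute)
qed

lemma finite_ds_lengths:
  "finite {length u | u :: nat list. davenport_schinzel s u \<and> card (set u) = n}"
proof (rule finite_subset)
  show "{length u | u :: nat list. davenport_schinzel s u \<and> card (set u) = n}
        \<subseteq> {..1 + (s + 1) * n ^ 2}"
    using davenport_schinzel_length_le by fastforce
qed simp

text \<open>Only the pattern of equalities between the entries matters, so the symbols are taken
  to be natural numbers. The sequences counted use exactly \<open>n\<close> symbols. The set is finite by
  \<open>finite_ds_lengths\<close>, so \<^const>\<open>Max\<close> is a genuine maximum (for \<open>s \<ge> 1\<close> the set
  is nonempty, too).\<close>

definition ds_lambda :: "nat \<Rightarrow> nat \<Rightarrow> nat" where
  "ds_lambda s n = Max {length u | u :: nat list. davenport_schinzel s u \<and> card (set u) = n}"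

text \<open>The hierarchy is only ever applied to natural numbers, and its values there are natural
  numbers. It starts at \<open>k = 1\<close>; the value at the dummy index \<open>k = 0\<close> is irrelevant.\<close>

function alpha_hier :: "nat \<Rightarrow> nat \<Rightarrow> nat" where
  "alpha_hier k x =
     (if k \<le> 1 then nat \<lceil>real x / 2\<rceil>
      else if x \<le> 1 then 0
      else 1 + alpha_hier k (alpha_hier (k - 1) x))"
  by auto

lemma nat_ceiling_half: "nat \<lceil>real x / 2\<rceil> = (x + 1) div 2"
  by linarith

lemma alpha_hier_less_aux:
  "alpha_hier_dom (k, x) \<Longrightarrow> alpha_hier_dom (k, x) \<and> (x \<ge> 2 \<longrightarrow> alpha_hier k x < x)"
proof (induction k x rule: alpha_hier.pinduct)
  case (1 k x)
  have "alpha_hier k x < x" if x: "x \<ge> 2"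
  proof (cases "k \<le> 1")
    case True
    then show ?thesis
      using x by (simp add: alpha_hier.psimps[OF "1.hyps"] nat_ceiling_half)
  next
    case False
    let ?y = "alpha_hier (k - 1) x"
    have y: "?y < x" using "1.IH"(1) False x by simp
    have dy: "alpha_hier_dom (k, ?y)" and IH: "?y \<ge> 2 \<Longrightarrow> alpha_hier k ?y < ?y"
      using "1.IH"(2) False x by auto
    have "alpha_hier k ?y < x - 1"
    proof (cases "?y \<le> 1")
      case True
      then show ?thesis using False x by (subst alpha_hier.psimps[OF dy]) simp
    next
      case F: False
      then show ?thesis using IH y by linarith
    qed
    then show ?thesis using False x by (simp add: alpha_hier.psimps[OF "1.hyps"])
  qed
  then show ?case using "1.hyps" by blast
qed

lemma alpha_hier_total: "All alpha_hier_dom"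
  by (relation "measures [fst, snd]") (use alpha_hier_less_aux in auto)

termination alpha_hier
  by (rule alpha_hier_total)

declare alpha_hier.simps [simp del]

lemma alpha_hier_less: "x \<ge> 2 \<Longrightarrow> alpha_hier k x < x"
  using alpha_hier_less_aux alpha_hier_total by blast

lemma alpha_hier_le_minus_2: "x \<ge> 4 \<Longrightarrow> alpha_hier k x \<le> x - 2"
proof (induction k)
  case 0
  then show ?case by (simp add: alpha_hier.simps nat_ceiling_half)
next
  case (Suc k)
  show ?case
  proof (cases "k = 0")
    case True
    then show ?thesis using Suc.prems by (simp add: alpha_hier.simps nat_ceiling_half)
  next
    case False
    let ?y = "alpha_hier k x"
    have eq: "alpha_hier (Suc k) x = 1 + alpha_hier (Suc k) ?y"
      using False Suc.prems by (subst alpha_hier.simps) simp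
    show ?thesis
    proof (cases "?y \<le> 1")
      case True
      then have "alpha_hier (Suc k) ?y = 0"
        using False by (subst alpha_hier.simps) simp
      then show ?thesis using eq Suc.prems by simp
    next
      case F: False
      then have "alpha_hier (Suc k) ?y < ?y" by (intro alpha_hier_less) simp
      then show ?thesis using eq Suc by simp
    qed
  qed
qed

lemma alpha_hier_eventually_le_3: "\<exists>k\<ge>1. alpha_hier k x \<le> 3"
proof (rule ccontr)
  assume "\<not> ?thesis"
  then have ge4: "alpha_hier k x \<ge> 4" if "k \<ge> 1" for k
    using that by fastforce
  have x: "x \<ge> 2" using ge4[of 1] by (simp add: alpha_hier.simps nat_ceiling_half)
  have "alpha_hier (Suc k) x + k \<le> x" for k
  proof (induction k)
    case 0
    then show ?case using alpha_hier_less[OF x, of 1] by simp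
  next
    case (Suc k)
    have "alpha_hier (Suc (Suc k)) x = 1 + alpha_hier (Suc (Suc k)) (alpha_hier (Suc k) x)"
      using x by (subst alpha_hier.simps) simp
    then show ?case
      using alpha_hier_le_minus_2[of "alpha_hier (Suc k) x" "Suc (Suc k)"] ge4[of "Suc k"] Suc
      by simp
  qed
  from this[of x] ge4[of "Suc x"] show False by simp
qed

text \<open>The minimum exists by \<open>alpha_hier_eventually_le_3\<close>.\<close>

definition inverse_ackermann :: "nat \<Rightarrow> nat" where
  "inverse_ackermann x = (LEAST k. k \<ge> 1 \<and> alpha_hier k x \<le> 3)"

end

theory Submission
  imports Defs "HOL-Library.Nat_Bijection"
begin

text \<open>In an order-3 sequence that is cut into intervals, each symbol can occur twice in the interval
  of its first occurrence and twice in that of its last, but only once in the others. Raising the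
  level by one therefore gains two occurrences per symbol. A sequence of level \<open>d\<close> has special
  blocks of equal length \<open>m\<close> which hold only first and last occurrences, and every symbol lies in
  two of them. Put into each special block \<open>a\<^sub>1 \<dots> a\<^sub>f\<close> of a level \<open>d - 1\<close> sequence a fresh copy of
  the level \<open>d\<close> sequence with blocks of length \<open>m - 1\<close> and \<open>f\<close> special blocks, the symbol \<open>a\<^sub>i\<close> going
  into the \<open>i\<close>-th one; the last occurrences among the \<open>a\<^sub>i\<close> are in addition listed in reverse
  before the copy, and the first ones in reverse after it. What survives the induction is that
  the sequence stays of order 3 when these reversed lists are added around all special
  blocks. The number of special blocks grows like the Ackermann hierarchy, with the level
  shifted by a constant.\<close>

text \<open>\<open>L\<close> lists the symbols occurring for the last time, \<open>F\<close> those occurring for the first time.\<close>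

datatype 'a blk = Reg "'a list" | Spec "'a list" "'a list"

fun cont :: "'a blk \<Rightarrow> 'a list" where
  "cont (Reg w) = w"
| "cont (Spec L F) = L @ F"

fun lasts :: "'a blk \<Rightarrow> 'a list" where
  "lasts (Reg w) = []"
| "lasts (Spec L F) = L"

fun firsts :: "'a blk \<Rightarrow> 'a list" where
  "firsts (Reg w) = []"
| "firsts (Spec L F) = F"

text \<open>The reversal matters: two symbols of \<open>L\<close> alternate only three times in
  \<open>rev L @ L\<close>, but four times in \<open>L @ L\<close>.\<close>

fun dcont :: "'a blk \<Rightarrow> 'a list" where
  "dcont (Reg w) = w"
| "dcont (Spec L F) = rev L @ L @ F @ rev F"

definition flat :: "'a blk list \<Rightarrow> 'a list" where
  "flat Z = concat (map cont Z)"

definition dflat :: "'a blk list \<Rightarrow> 'a list" where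
  "dflat Z = concat (map dcont Z)"

lemma flat_simps [simp]:
  "flat [] = []" "flat (b # Z) = cont b @ flat Z" "flat (Z @ Z') = flat Z @ flat Z'"
  by (auto simp: flat_def)

lemma dflat_simps [simp]:
  "dflat [] = []" "dflat (b # Z) = dcont b @ dflat Z" "dflat (Z @ Z') = dflat Z @ dflat Z'"
  by (auto simp: dflat_def)

lemma set_dcont [simp]: "set (dcont b) = set (cont b)"
  by (cases b) auto

lemma set_dflat [simp]: "set (dflat Z) = set (flat Z)"
  by (induction Z) auto

fun is_spec :: "'a blk \<Rightarrow> bool" where
  "is_spec (Reg w) = False"
| "is_spec (Spec L F) = True"

definition nspec :: "'a blk list \<Rightarrow> nat" where
  "nspec Z = length (filter is_spec Z)"

definition nreg :: "'a blk list \<Rightarrow> nat" where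
  "nreg Z = length (filter (\<lambda>b. \<not> is_spec b) Z)"

lemma nspec_simps [simp]:
  "nspec [] = 0" "nspec (Reg w # Z) = nspec Z" "nspec (Spec L F # Z) = Suc (nspec Z)"
  "nspec (Z @ Z') = nspec Z + nspec Z'"
  by (auto simp: nspec_def)

lemma nreg_simps [simp]:
  "nreg [] = 0" "nreg (Reg w # Z) = Suc (nreg Z)" "nreg (Spec L F # Z) = nreg Z"
  "nreg (Z @ Z') = nreg Z + nreg Z'"
  by (auto simp: nreg_def)

text \<open>Along a sorted list this makes the entries of \<open>L\<close> and \<open>F\<close>
  genuine last and first occurrences.\<close>

definition prec :: "'a blk \<Rightarrow> 'a blk \<Rightarrow> bool" where
  "prec b c \<longleftrightarrow> set (lasts b) \<inter> set (cont c) = {} \<and> set (cont b) \<inter> set (firsts c) = {}"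

definition wf_blks :: "nat \<Rightarrow> 'a blk list \<Rightarrow> bool" where
  "wf_blks m Z \<longleftrightarrow> sorted_wrt prec Z \<and> (\<forall>b\<in>set Z. distinct (cont b)) \<and>
     (\<forall>b\<in>set Z. is_spec b \<longrightarrow> length (cont b) = m)"

lemma wf_blks_Nil [simp]: "wf_blks m []"
  by (simp add: wf_blks_def)

lemma wf_blks_Cons [simp]:
  "wf_blks m (b # Z) \<longleftrightarrow> (\<forall>c\<in>set Z. prec b c) \<and> distinct (cont b) \<and>
     (is_spec b \<longrightarrow> length (cont b) = m) \<and> wf_blks m Z"
  by (auto simp: wf_blks_def)

lemma wf_blks_append [simp]:
  "wf_blks m (Y @ Z) \<longleftrightarrow> wf_blks m Y \<and> wf_blks m Z \<and> (\<forall>b\<in>set Y. \<forall>c\<in>set Z. prec b c)"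
  by (auto simp: wf_blks_def sorted_wrt_append)

text \<open>The order 3 condition without the ban on adjacent equal entries: the construction
  creates such entries, and \<open>remdups_adj\<close> removes them at the end.\<close>

definition avoids :: "'a list \<Rightarrow> bool" where
  "avoids w \<longleftrightarrow> (\<forall>x y. x \<noteq> y \<longrightarrow> \<not> subseq [x, y, x, y, x] w)"

subsection \<open>Renaming of symbols\<close>

lemma map_blk_simps [simp]:
  "cont (map_blk f b) = map f (cont b)" "dcont (map_blk f b) = map f (dcont b)"
  "lasts (map_blk f b) = map f (lasts b)" "firsts (map_blk f b) = map f (firsts b)"
  "is_spec (map_blk f b) = is_spec b"
  by (cases b; simp add: rev_map)+

lemma map_blks_simps [simp]:
  "flat (map (map_blk f) Z) = map f (flat Z)" "dflat (map (map_blk f) Z) = map f (dflat Z)"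
  "nspec (map (map_blk f) Z) = nspec Z" "nreg (map (map_blk f) Z) = nreg Z"
  by (auto simp: flat_def dflat_def nspec_def nreg_def map_concat comp_def filter_map)

lemma avoids_map:
  assumes "inj f" "avoids w" shows "avoids (map f w)"
  unfolding avoids_def
proof (intro allI impI notI)
  fix x y assume xy: "x \<noteq> y" and s: "subseq [x, y, x, y, x] (map f w)"
  then obtain N where "[x, y, x, y, x] = nths (map f w) N" by (auto simp: subseq_conv_nths)
  then obtain v where v: "subseq v w" "[x, y, x, y, x] = map f v"
    by (metis nths_map subseq_conv_nths)
  then obtain a b a' b' a'' where "v = [a, b, a', b', a'']" "x = f a" "y = f b" "x = f a'" "y = f b'" "x = f a''"
    by (auto simp: Cons_eq_map_conv)
  then have "v = [a, b, a, b, a]" "a \<noteq> b" using assms(1) xy by (auto dest: injD)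
  then show False using assms(2) v by (auto simp: avoids_def)
qed

lemma wf_blks_map:
  assumes "inj f" shows "wf_blks m Z \<Longrightarrow> wf_blks m (map (map_blk f) Z)"
proof (induction Z)
  case (Cons b Z)
  have "prec b c \<Longrightarrow> prec (map_blk f b) (map_blk f c)" for b c
    using assms by (auto simp: prec_def dest: injD)
  then show ?case using Cons assms by (auto simp: distinct_map intro: inj_on_subset)
qed simp

subsection \<open>Doubling the special blocks\<close>

fun dblb :: "'a blk \<Rightarrow> 'a blk list" where
  "dblb (Reg w) = [Reg w]"
| "dblb (Spec L F) = [Reg (rev L), Spec L F, Reg (rev F)]"

definition dbl :: "'a blk list \<Rightarrow> 'a blk list" where
  "dbl Z = concat (map dblb Z)"

lemma dbl_simps [simp]: "dbl [] = []" "dbl (b # Z) = dblb b @ dbl Z"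
  by (auto simp: dbl_def)

lemma flat_dbl [simp]: "flat (dbl Z) = dflat Z"
proof (induction Z)
  case (Cons b Z)
  then show ?case by (cases b) auto
qed simp

lemma nspec_dbl [simp]: "nspec (dbl Z) = nspec Z"
proof (induction Z)
  case (Cons b Z)
  then show ?case by (cases b) auto
qed simp

lemma nreg_dbl [simp]: "nreg (dbl Z) = nreg Z + 2 * nspec Z"
proof (induction Z)
  case (Cons b Z)
  then show ?case by (cases b) auto
qed simp

lemma dblb_parts:
  assumes "c \<in> set (dblb b)"
  shows "set (cont c) \<subseteq> set (cont b)" "set (lasts c) \<subseteq> set (lasts b)" "set (firsts c) \<subseteq> set (firsts b)"
  using assms by (cases b; auto)+

text \<open>\<open>rev L\<close> comes before the block and \<open>rev F\<close> after it, so the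
  entries of \<open>L\<close> and \<open>F\<close> are still last and first occurrences.\<close>

lemma wf_blks_dbl: "wf_blks m Z \<Longrightarrow> wf_blks m (dbl Z)"
proof (induction Z)
  case (Cons b Z)
  have "prec c c'" if c: "c \<in> set (dblb b)" and c': "c' \<in> set (dbl Z)" for c c'
  proof -
    from c' obtain b' where b': "b' \<in> set Z" "c' \<in> set (dblb b')" by (auto simp: dbl_def)
    then have "prec b b'" using Cons.prems by simp
    then show ?thesis
      using dblb_parts[OF c] dblb_parts[OF b'(2)] unfolding prec_def by blast
  qed
  moreover have "wf_blks m (dblb b)"
    using Cons.prems by (cases b) (auto simp: prec_def)
  ultimately show ?case
    using Cons by simp
qed simp

subsection \<open>Insertion of symbols into the special blocks\<close>

text \<open>On which side the new symbol goes matters: with the new last occurrence placed after the old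
  ones, two symbols in \<open>L\<close> would alternate five times once the block is doubled.\<close>

fun ins1 :: "bool \<times> 'a \<Rightarrow> 'a list \<Rightarrow> 'a list \<Rightarrow> 'a blk" where
  "ins1 (True, a) L F = Spec (a # L) F"
| "ins1 (False, a) L F = Spec L (F @ [a])"

fun ins :: "(bool \<times> 'a) list \<Rightarrow> 'a blk list \<Rightarrow> 'a blk list" where
  "ins ps [] = []"
| "ins ps (Reg w # Z) = Reg w # ins ps Z"
| "ins [] (Spec L F # Z) = Spec L F # ins [] Z"
| "ins (p # ps) (Spec L F # Z) = ins1 p L F # ins ps Z"

lemma ins1_simps [simp]:
  "set (cont (ins1 p L F)) = insert (snd p) (set L \<union> set F)"
  "length (cont (ins1 p L F)) = Suc (length L + length F)"
  "is_spec (ins1 p L F)"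
  by (cases "(p, L, F)" rule: ins1.cases; simp)+

lemma nspec_ins1 [simp]: "nspec (ins1 p L F # Z) = Suc (nspec Z)" "nreg (ins1 p L F # Z) = nreg Z"
  by (auto simp: nspec_def nreg_def)

lemma filter_dcont_ins1 [simp]:
  "\<not> P (snd p) \<Longrightarrow> filter P (dcont (ins1 p L F)) = filter P (dcont (Spec L F))"
  by (cases "(p, L, F)" rule: ins1.cases) auto

lemma nspec_ins [simp]: "nspec (ins ps Z) = nspec Z"
  by (induction ps Z rule: ins.induct) auto

lemma nreg_ins [simp]: "nreg (ins ps Z) = nreg Z"
  by (induction ps Z rule: ins.induct) auto

lemma set_flat_ins: "length ps = nspec Z \<Longrightarrow> set (flat (ins ps Z)) = set (flat Z) \<union> snd ` set ps"
  by (induction ps Z rule: ins.induct) auto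

lemma length_flat_ins: "length ps = nspec Z \<Longrightarrow> length (flat (ins ps Z)) = length (flat Z) + length ps"
  by (induction ps Z rule: ins.induct) auto

lemma filter_ins_old:
  "\<forall>p\<in>set ps. \<not> P (snd p) \<Longrightarrow> filter P (dflat (ins ps Z)) = filter P (dflat Z)"
  by (induction ps Z rule: ins.induct) auto

text \<open>A new last occurrence heads \<open>L\<close> and so ends \<open>rev L\<close>; a new
  first one ends \<open>F\<close> and so heads \<open>rev F\<close>. Either way its two copies in
  the doubled block are adjacent.\<close>

lemma dcont_ins1: 
  "\<exists>u v. dcont (ins1 p L F) = u @ [snd p, snd p] @ v \<and> set u \<union> set v = set L \<union> set F"
proof (cases "(p, L, F)" rule: ins1.cases)
  case (1 a L' F')
  then show ?thesis by (intro exI[of _ "rev L"] exI[of _ "L @ F @ rev F"]) auto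
next
  case (2 a L' F')
  then show ?thesis by (intro exI[of _ "rev L @ L @ F"] exI[of _ "rev F"]) auto
qed

lemma filter_ins_new:
  "\<lbrakk>length ps = nspec Z; \<forall>p\<in>set ps. P (snd p); \<forall>x\<in>set (flat Z). \<not> P x\<rbrakk> \<Longrightarrow>
   filter P (dflat (ins ps Z)) = concat (map (\<lambda>a. [a, a]) (map snd ps))"
proof (induction ps Z rule: ins.induct)
  case (4 p ps L F Z)
  obtain u v where uv: "dcont (ins1 p L F) = u @ [snd p, snd p] @ v" "set u \<union> set v = set L \<union> set F"
    using dcont_ins1 by metis
  have "\<forall>x\<in>set u \<union> set v. \<not> P x" using 4(4) by (subst uv(2)) auto
  then have "filter P u = []" "filter P v = []" by (auto simp: filter_empty_conv)
  then show ?case using 4 uv(1) by simp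
qed auto

lemma dflat_ins_split:
  "\<lbrakk>distinct (map snd ps); a \<in> snd ` set ps; a \<notin> set (flat Z); length ps = nspec Z\<rbrakk> \<Longrightarrow>
   \<exists>u v. dflat (ins ps Z) = u @ [a, a] @ v \<and> a \<notin> set u \<and> a \<notin> set v"
proof (induction ps Z rule: ins.induct)
  case (2 ps w Z)
  then obtain u v where "dflat (ins ps Z) = u @ [a, a] @ v" "a \<notin> set u" "a \<notin> set v" by auto
  then show ?case using 2 by (intro exI[of _ "w @ u"] exI[of _ v]) auto
next
  case (4 p ps L F Z)
  show ?case
  proof (cases "a = snd p")
    case True
    obtain u v where uv: "dcont (ins1 p L F) = u @ [snd p, snd p] @ v" "set u \<union> set v = set L \<union> set F"
      using dcont_ins1 by metis
    moreover have "a \<notin> set (flat (ins ps Z))" using 4 True by (subst set_flat_ins) auto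
    ultimately show ?thesis
      using 4 True by (intro exI[of _ u] exI[of _ "v @ dflat (ins ps Z)"]) auto
  next
    case False
    then obtain u v where "dflat (ins ps Z) = u @ [a, a] @ v" "a \<notin> set u" "a \<notin> set v" using 4 by auto
    then show ?thesis using 4 False by (intro exI[of _ "dcont (ins1 p L F) @ u"] exI[of _ v]) auto
  qed
qed auto

lemma ins_parts:
  assumes "c \<in> set (ins ps Z)"
  shows "\<exists>b\<in>set Z. set (cont c) \<subseteq> set (cont b) \<union> snd ` set ps \<and>
    set (lasts c) \<subseteq> set (lasts b) \<union> {a. (True, a) \<in> set ps} \<and>
    set (firsts c) \<subseteq> set (firsts b) \<union> {a. (False, a) \<in> set ps}"
  using assms
proof (induction ps Z rule: ins.induct)
  case (4 p ps L F Z)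
  then consider "c = ins1 p L F" | "c \<in> set (ins ps Z)" by auto
  then show ?case
  proof cases
    case 1
    then show ?thesis
      by (intro bexI[of _ "Spec L F"]; cases "(p, L, F)" rule: ins1.cases) auto
  next
    case 2
    then obtain b where "b \<in> set Z" "set (cont c) \<subseteq> set (cont b) \<union> snd ` set ps \<and>
      set (lasts c) \<subseteq> set (lasts b) \<union> {a. (True, a) \<in> set ps} \<and>
      set (firsts c) \<subseteq> set (firsts b) \<union> {a. (False, a) \<in> set ps}" using 4 by blast
    then show ?thesis by (intro bexI[of _ b]) auto
  qed
qed auto

lemma set_cont_subset_flat: "b \<in> set Z \<Longrightarrow> set (cont b) \<subseteq> set (flat Z)"
  by (auto simp: flat_def)

lemma set_lasts_subset: "set (lasts b) \<subseteq> set (cont b)"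
  and set_firsts_subset: "set (firsts b) \<subseteq> set (cont b)"
  by (cases b; auto)+

text \<open>An inserted symbol is fresh and enters a single block, so \<open>prec\<close> holds for
  either flag; the flags matter only against the outer sequence.\<close>

lemma wf_blks_ins:
  "\<lbrakk>wf_blks m Z; distinct (map snd ps); snd ` set ps \<inter> set (flat Z) = {}; length ps = nspec Z\<rbrakk> \<Longrightarrow>
   wf_blks (Suc m) (ins ps Z)"
proof (induction ps Z rule: ins.induct)
  case (2 ps w Z)
  have "prec (Reg w) c" if c: "c \<in> set (ins ps Z)" for c
  proof -
    obtain b where b: "b \<in> set Z" "set (firsts c) \<subseteq> set (firsts b) \<union> {a. (False, a) \<in> set ps}"
      using ins_parts[OF c] by blast
    moreover have "prec (Reg w) b" using 2 b by auto
    moreover have "set w \<inter> snd ` set ps = {}" using 2 by auto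
    ultimately show ?thesis by (force simp: prec_def)
  qed
  then show ?case using 2 by auto
next
  case (4 p ps L F Z)
  have "prec (ins1 p L F) c" if c: "c \<in> set (ins ps Z)" for c
  proof -
    obtain b where b: "b \<in> set Z" "set (cont c) \<subseteq> set (cont b) \<union> snd ` set ps"
      "set (firsts c) \<subseteq> set (firsts b) \<union> {a. (False, a) \<in> set ps}"
      using ins_parts[OF c] by blast
    have disj: "(set L \<union> set F) \<inter> snd ` set ps = {}" "snd p \<notin> set (flat Z)" "snd p \<notin> snd ` set ps"
      using 4 by auto
    have "prec (Spec L F) b" using 4 b by auto
    then have pr: "set L \<inter> set (cont b) = {}" "(set L \<union> set F) \<inter> set (firsts b) = {}"
      by (auto simp: prec_def)
    have *: "snd p \<notin> set (cont b)" "snd p \<notin> set (firsts b)"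
      using set_cont_subset_flat[OF b(1)] set_firsts_subset[of b] disj by auto
    have la: "set (lasts (ins1 p L F)) \<subseteq> insert (snd p) (set L)"
      by (cases "(p, L, F)" rule: ins1.cases) auto
    have ps: "{a. (False, a) \<in> set ps} \<subseteq> snd ` set ps" by force
    have "set (lasts (ins1 p L F)) \<inter> set (cont c) = {}"
      using la b(2) disj(1,3) pr(1) *(1) by (smt (verit) Int_iff UnE UnI1 disjoint_iff insertE subsetD)
    moreover have "set (cont (ins1 p L F)) \<inter> set (firsts c) = {}"
      using b(3) ps disj(1,3) pr(2) *(2) unfolding ins1_simps
      by (smt (verit) Int_iff UnE disjoint_iff insertE subsetD)
    ultimately show ?thesis by (simp add: prec_def)
  qed
  moreover have "distinct (cont (ins1 p L F))"
    using 4 by (cases "(p, L, F)" rule: ins1.cases) auto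
  moreover have "wf_blks (Suc m) (ins ps Z)" using 4 by (intro 4) auto
  ultimately show ?case using 4 by auto
qed auto

subsection \<open>Composition\<close>

definition tags :: "'a list \<Rightarrow> 'a list \<Rightarrow> (bool \<times> nat \<times> 'a) list" where
  "tags L F = map (\<lambda>a. (True, 0, a)) L @ map (\<lambda>a. (False, 0, a)) F"

lemma tags_simps [simp]:
  "length (tags L F) = length L + length F" "snd ` set (tags L F) = Pair 0 ` (set L \<union> set F)"
  "map snd (tags L F) = map (Pair 0) (L @ F)"
  "(True, p) \<in> set (tags L F) \<longleftrightarrow> p \<in> Pair 0 ` set L"
  "(False, p) \<in> set (tags L F) \<longleftrightarrow> p \<in> Pair 0 ` set F"
  by (force simp: tags_def)+

definition copy :: "'a blk list \<Rightarrow> nat \<Rightarrow> (nat \<times> 'a) blk list" where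
  "copy Z i = map (map_blk (Pair (Suc i))) Z"

lemma inj_Pair [simp]: "inj (Pair i)"
  by (auto intro: injI)

lemma copy_simps [simp]:
  "flat (copy Z i) = map (Pair (Suc i)) (flat Z)" "dflat (copy Z i) = map (Pair (Suc i)) (dflat Z)"
  "nspec (copy Z i) = nspec Z" "nreg (copy Z i) = nreg Z"
  by (auto simp: copy_def)

text \<open>The first component of a symbol is \<open>0\<close> for the outer sequence and \<open>Suc i\<close> for the copy inserted at
  its \<open>i\<close>-th special block.\<close>

fun comp_blks :: "'a blk list \<Rightarrow> nat \<Rightarrow> 'a blk list \<Rightarrow> (nat \<times> 'a) blk list" where
  "comp_blks Z i [] = []"
| "comp_blks Z i (Reg w # Y) = Reg (map (Pair 0) w) # comp_blks Z i Y"
| "comp_blks Z i (Spec L F # Y) = ins (tags L F) (copy Z i) @ comp_blks Z (Suc i) Y"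

lemma comp_blks_append:
  "comp_blks Z i (Y @ Y') = comp_blks Z i Y @ comp_blks Z (i + nspec Y) Y'"
  by (induction Z i Y rule: comp_blks.induct) auto

lemma nspec_comp [simp]: "nspec (comp_blks Z i Y) = nspec Y * nspec Z"
  by (induction Z i Y rule: comp_blks.induct) auto

lemma nreg_comp [simp]: "nreg (comp_blks Z i Y) = nreg Y + nspec Y * nreg Z"
  by (induction Z i Y rule: comp_blks.induct) auto

text \<open>By the hypothesis the special blocks of \<open>Y\<close> are as long as \<open>Z\<close>
  has special blocks, so each of their symbols finds exactly one place in the copy.\<close>

lemma length_flat_comp:
  "wf_blks (nspec Z) Y \<Longrightarrow> length (flat (comp_blks Z i Y)) = length (flat Y) + nspec Y * length (flat Z)"
  by (induction Z i Y rule: comp_blks.induct) (auto simp: length_flat_ins)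

lemma set_flat_comp:
  "wf_blks (nspec Z) Y \<Longrightarrow> set (flat (comp_blks Z i Y)) =
     Pair 0 ` set (flat Y) \<union> {Suc i..<Suc (i + nspec Y)} \<times> set (flat Z)"
proof (induction Z i Y rule: comp_blks.induct)
  case (3 Z i L F Y)
  have "{Suc i..<Suc (i + nspec (Spec L F # Y))} = insert (Suc i) {Suc (Suc i)..<Suc (Suc i + nspec Y)}"
    by auto
  then show ?case using 3 by (auto simp: set_flat_ins)
qed auto

text \<open>A crude bound on the copy symbols suffices: with first component above \<open>i\<close>
  they are neither outer symbols nor symbols of earlier copies.\<close>

lemma comp_parts:
  assumes "wf_blks (nspec Z) Y" "c \<in> set (comp_blks Z i Y)"
  shows "\<exists>b\<in>set Y. set (cont c) \<subseteq> Pair 0 ` set (cont b) \<union> {p. fst p > i} \<and>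
    set (lasts c) \<subseteq> Pair 0 ` set (lasts b) \<union> {p. fst p > i} \<and>
    set (firsts c) \<subseteq> Pair 0 ` set (firsts b) \<union> {p. fst p > i}"
  using assms
proof (induction Z i Y rule: comp_blks.induct)
  case (2 Z i w Y)
  then show ?case by (cases "c = Reg (map (Pair 0) w)") auto
next
  case (3 Z i L F Y)
  then consider "c \<in> set (ins (tags L F) (copy Z i))" | "c \<in> set (comp_blks Z (Suc i) Y)" by auto
  then show ?case
  proof cases
    case 1
    then obtain b where b: "b \<in> set (copy Z i)" "set (cont c) \<subseteq> set (cont b) \<union> Pair 0 ` (set L \<union> set F)"
      "set (lasts c) \<subseteq> set (lasts b) \<union> Pair 0 ` set L" "set (firsts c) \<subseteq> set (firsts b) \<union> Pair 0 ` set F"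
      using ins_parts[OF 1] by auto
    have "set (cont b) \<subseteq> {p. fst p > i}" using set_cont_subset_flat[OF b(1)] by auto
    then show ?thesis
      using b set_lasts_subset[of b] set_firsts_subset[of b]
      by (intro bexI[of _ "Spec L F"]) (simp; blast)+
  next
    case 2
    then obtain b where "b \<in> set Y" "set (cont c) \<subseteq> Pair 0 ` set (cont b) \<union> {p. fst p > Suc i} \<and>
      set (lasts c) \<subseteq> Pair 0 ` set (lasts b) \<union> {p. fst p > Suc i} \<and>
      set (firsts c) \<subseteq> Pair 0 ` set (firsts b) \<union> {p. fst p > Suc i}" using 3 by auto
    moreover have "{p :: nat \<times> 'a. fst p > Suc i} \<subseteq> {p. fst p > i}" by auto
    ultimately show ?thesis by (intro bexI[of _ b]) (blast | simp)+
  qed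
qed auto

lemma wf_blks_comp:
  assumes "wf_blks m Z"
  shows "wf_blks (nspec Z) Y \<Longrightarrow> wf_blks (Suc m) (comp_blks Z i Y)"
  using assms
proof (induction Z i Y rule: comp_blks.induct)
  case (2 Z i w Y)
  have "prec (Reg (map (Pair 0) w)) c" if c: "c \<in> set (comp_blks Z i Y)" for c
  proof -
    obtain b where b: "b \<in> set Y" "set (firsts c) \<subseteq> Pair 0 ` set (firsts b) \<union> {p. fst p > i}"
      using comp_parts[OF _ c] 2 by auto
    moreover have "prec (Reg w) b" using 2 b by auto
    ultimately show ?thesis by (fastforce simp: prec_def)
  qed
  then show ?case using 2 by (auto simp: distinct_map intro: inj_onI)
next
  case (3 Z i L F Y)
  have "prec c' c" if c: "c \<in> set (comp_blks Z (Suc i) Y)" and c': "c' \<in> set (ins (tags L F) (copy Z i))" for c c'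
  proof -
    obtain b where b: "b \<in> set Y" "set (cont c) \<subseteq> Pair 0 ` set (cont b) \<union> {p. fst p > Suc i}"
      "set (firsts c) \<subseteq> Pair 0 ` set (firsts b) \<union> {p. fst p > Suc i}"
      using comp_parts[OF _ c] 3 by auto
    obtain b' where b': "b' \<in> set (copy Z i)" "set (cont c') \<subseteq> set (cont b') \<union> Pair 0 ` (set L \<union> set F)"
      "set (lasts c') \<subseteq> set (lasts b') \<union> Pair 0 ` set L"
      using ins_parts[OF c'] by auto
    have sub: "set (cont b') \<subseteq> {p. fst p = Suc i}" using set_cont_subset_flat[OF b'(1)] by auto
    then have sub': "set (lasts b') \<subseteq> {p. fst p = Suc i}" using set_lasts_subset[of b'] by auto
    have "prec (Spec L F) b" using 3 b by auto
    then have pr: "set L \<inter> set (cont b) = {}" "(set L \<union> set F) \<inter> set (firsts b) = {}"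
      by (auto simp: prec_def)
    have "set (lasts c') \<subseteq> {p. fst p = Suc i} \<union> Pair 0 ` set L"
      "set (cont c') \<subseteq> {p. fst p = Suc i} \<union> Pair 0 ` (set L \<union> set F)"
      using b' sub sub' by blast+
    then show ?thesis unfolding prec_def using b(2,3) pr by fastforce
  qed
  moreover have "wf_blks (Suc m) (ins (tags L F) (copy Z i))"
  proof (rule wf_blks_ins)
    show "wf_blks m (copy Z i)" using 3 by (simp add: copy_def wf_blks_map)
    show "distinct (map snd (tags L F))" using 3 by (auto simp: distinct_map intro: inj_onI)
  qed (use 3 in auto)
  ultimately show ?case using 3 by auto
qed auto

section \<open>Alternations in the composition\<close>

lemma filter_comp_outer:
  "wf_blks (nspec Z) Y \<Longrightarrow> filter (\<lambda>p. fst p = 0) (dflat (comp_blks Z i Y)) =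
     concat (map (\<lambda>b. if is_spec b then concat (map (\<lambda>a. [(0, a), (0, a)]) (cont b)) else map (Pair 0) (cont b)) Y)"
proof (induction Z i Y rule: comp_blks.induct)
  case (3 Z i L F Y)
  have "filter (\<lambda>p. fst p = 0) (dflat (ins (tags L F) (copy Z i))) =
    concat (map (\<lambda>a. [a, a]) (map snd (tags L F)))"
    using 3 by (intro filter_ins_new) (auto simp: tags_def)
  then show ?case using 3 by (simp add: comp_def)
qed (auto simp: filter_map comp_def)

text \<open>Without the inserted symbols the copy is still doubled, which is why
  \<open>avoids_comp\<close> needs \<open>avoids (dflat Z)\<close>.\<close>

lemma filter_comp_copy:
  "filter (\<lambda>p. fst p = Suc k) (dflat (comp_blks Z i Y)) =
     (if i \<le> k \<and> k < i + nspec Y then map (Pair (Suc k)) (dflat Z) else [])"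
proof (induction Z i Y rule: comp_blks.induct)
  case (3 Z i L F Y)
  have "filter (\<lambda>p. fst p = Suc k) (dflat (ins (tags L F) (copy Z i))) =
    filter (\<lambda>p. fst p = Suc k) (dflat (copy Z i))"
    by (intro filter_ins_old) (auto simp: tags_def)
  then show ?case using 3 by (auto simp: filter_map comp_def)
qed (auto simp: filter_map comp_def)

lemma set_subseq: "subseq v w \<Longrightarrow> set v \<subseteq> set w"
  by (metis set_nths_subset subseq_conv_nths)

text \<open>Of two adjacent equal letters an alternation can use only one. So the doubled letters in
  \<open>filter_comp_outer\<close> do no harm, and \<open>avoids (flat Y)\<close> is enough for two
  outer symbols.\<close>

lemma subseq_dup:
  "\<lbrakk>subseq p (concat (map (\<lambda>a. [g a, g a]) v)); distinct_adj p\<rbrakk> \<Longrightarrow> subseq p (map g v)"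
proof (induction v arbitrary: p)
  case (Cons a v)
  then obtain q r where qr: "p = q @ r" "subseq q [g a, g a]" "subseq r (concat (map (\<lambda>a. [g a, g a]) v))"
    using subseq_append_iff[of p "[g a, g a]"] by auto
  have "distinct_adj q" "distinct_adj r" using Cons.prems qr(1) by (auto simp: distinct_adj_append_iff)
  moreover have "subseq q [g a]"
  proof (cases q)
    case q: (Cons x q')
    then have "set (x # q') \<subseteq> {g a}" using set_subseq[OF qr(2)] by simp
    then show ?thesis using q \<open>distinct_adj q\<close> by (cases q') auto
  qed simp
  ultimately show ?case using Cons.IH[OF qr(3)] qr(1) list_emb_append_mono[of "(=)" q "[g a]" r "map g v"] by simp
qed simp

lemma subseq_comp_outer:
  "\<lbrakk>subseq p (concat (map (\<lambda>b. if is_spec b then concat (map (\<lambda>a. [g a, g a]) (cont b)) else map g (cont b)) Y));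
    distinct_adj p\<rbrakk> \<Longrightarrow> subseq p (map g (flat Y))"
proof (induction Y arbitrary: p)
  case (Cons b Y)
  from Cons.prems(1)[simplified] obtain q r where qr: "p = q @ r"
    "subseq q (if is_spec b then concat (map (\<lambda>a. [g a, g a]) (cont b)) else map g (cont b))"
    "subseq r (concat (map (\<lambda>b. if is_spec b then concat (map (\<lambda>a. [g a, g a]) (cont b)) else map g (cont b)) Y))"
    by (rule subseq_appendE)
  have "distinct_adj q" "distinct_adj r" using Cons.prems qr(1) by (auto simp: distinct_adj_append_iff)
  moreover from this have "subseq q (map g (cont b))"
    using qr(2) subseq_dup by (auto split: if_splits)
  ultimately show ?case using Cons.IH[OF qr(3)] qr(1) by (simp add: list_emb_append_mono)
qed simp

lemma subseq_one_symbol: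
  assumes "subseq v W" "distinct_adj v" "set v \<subseteq> {p, q}" "p \<notin> set W"
  shows "length v \<le> 1"
proof -
  have "set v \<subseteq> {q}" using assms by (auto simp: subseq_conv_nths dest: notin_set_nthsI)
  then show ?thesis using assms(2) by (cases v rule: list.exhaust; cases "tl v") auto
qed

text \<open>Each stretch lacks one of the two symbols and so adds at most one entry; a forbidden
  alternation would need a fifth stretch.\<close>

lemma subseq_four_runs:
  assumes "subseq v (W1 @ W2 @ W3 @ W4)" "distinct_adj v" "set v \<subseteq> {p, q}"
    and "p \<notin> set W1" "q \<notin> set W2" "p \<notin> set W3" "q \<notin> set W4"
  shows "length v \<le> 4"
proof -
  obtain v1 v2 v3 v4 where v: "v = v1 @ v2 @ v3 @ v4" "subseq v1 W1" "subseq v2 W2" "subseq v3 W3" "subseq v4 W4"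
    using assms(1) unfolding subseq_append_iff by blast
  have d: "distinct_adj v1" "distinct_adj v2" "distinct_adj v3" "distinct_adj v4"
    using assms(2) by (auto simp: v(1) distinct_adj_append_iff)
  have "length v1 \<le> 1" "length v2 \<le> 1" "length v3 \<le> 1" "length v4 \<le> 1"
    using subseq_one_symbol[OF v(2) d(1), of p q] subseq_one_symbol[OF v(3) d(2), of q p]
      subseq_one_symbol[OF v(4) d(3), of p q] subseq_one_symbol[OF v(5) d(4), of q p] assms v(1) by auto
  then show ?thesis by (simp add: v(1))
qed

lemma split_at_spec:
  "k < nspec Y \<Longrightarrow> \<exists>Y1 L F Y2. Y = Y1 @ Spec L F # Y2 \<and> nspec Y1 = k"
proof (induction Y arbitrary: k)
  case (Cons b Y)
  show ?case
  proof (cases b)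
    case (Reg w)
    then obtain Y1 L F Y2 where "Y = Y1 @ Spec L F # Y2" "nspec Y1 = k" using Cons by fastforce
    then show ?thesis using Reg by (intro exI[of _ "Reg w # Y1"]) auto
  next
    case (Spec L F)
    show ?thesis
    proof (cases k)
      case 0
      then show ?thesis using Spec by (intro exI[of _ "[]"] exI[of _ L] exI[of _ F] exI[of _ Y]) auto
    next
      case (Suc k')
      then obtain Y1 L' F' Y2 where "Y = Y1 @ Spec L' F' # Y2" "nspec Y1 = k'" using Cons Spec by fastforce
      then show ?thesis using Spec Suc by (intro exI[of _ "Spec L F # Y1"]) auto
    qed
  qed
qed simp

text \<open>If \<open>q\<close> enters the copy containing \<open>p\<close> as a last occurrence, it is absent after that copy, and if
  as a first one, absent before it; in the doubled copy itself its two occurrences are adjacent.\<close>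

lemma comp_mixed_alternation:
  assumes wf: "wf_blks (nspec Z) Y" and p: "fst p = Suc k" and q: "fst q \<noteq> Suc k"
    and v: "subseq v (dflat (comp_blks Z 0 Y))" "distinct_adj v" "set v \<subseteq> {p, q}"
  shows "length v \<le> 4"
proof (cases "k < nspec Y")
  case False
  then have "p \<notin> set (dflat (comp_blks Z 0 Y))" using p by (auto simp: set_flat_comp[OF wf])
  then show ?thesis using subseq_one_symbol[OF v] by simp
next
  case True
  then obtain Y1 L F Y2 where Y: "Y = Y1 @ Spec L F # Y2" "nspec Y1 = k" using split_at_spec by metis
  define U1 M U2 where "U1 = dflat (comp_blks Z 0 Y1)" and "M = dflat (ins (tags L F) (copy Z k))"
    and "U2 = dflat (comp_blks Z (Suc k) Y2)"
  have W: "dflat (comp_blks Z 0 Y) = U1 @ M @ U2"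
    by (simp add: Y comp_blks_append U1_def M_def U2_def)
  have wf1: "wf_blks (nspec Z) Y1" "wf_blks (nspec Z) Y2" "length L + length F = nspec Z"
    using wf by (auto simp: Y)
  have pU: "p \<notin> set U1" "p \<notin> set U2"
    using p Y(2) by (auto simp: U1_def U2_def set_flat_comp wf1)
  have dj: "set L \<inter> set (flat Y2) = {}" "set F \<inter> set (flat Y1) = {}"
    using wf by (auto simp: Y prec_def flat_def)
  have setM: "set M = {Suc k} \<times> set (flat Z) \<union> Pair 0 ` (set L \<union> set F)"
    using wf1(3) by (auto simp: M_def set_flat_ins)
  show ?thesis
  proof (cases "q \<in> set M")
    case False
    then show ?thesis
      using subseq_four_runs[of v U1 M U2 "[]" p q] v pU W by simp
  next
    case True
    then obtain a where a: "q = (0, a)" "a \<in> set L \<or> a \<in> set F" using q by (auto simp: setM)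
    have "distinct (map snd (tags L F))" using wf by (auto simp: Y distinct_map intro: inj_onI)
    then obtain u u' where M: "M = u @ [q, q] @ u'" "q \<notin> set u" "q \<notin> set u'"
      using dflat_ins_split[of "tags L F" q "copy Z k"] a wf1 by (auto simp: M_def)
    have pq: "p \<noteq> q" using p q by auto
    from a(2) show ?thesis
    proof
      assume "a \<in> set L"
      then have "q \<notin> set U2" using dj a(1) by (auto simp: U2_def set_flat_comp wf1)
      \<comment> \<open>No \<open>p\<close> before the copy, no \<open>q\<close> up to its pair, no
        \<open>p\<close> in the pair, no \<open>q\<close> after it. The other case is the mirror
        image.\<close>
      then show ?thesis
        using subseq_four_runs[of v U1 u "[q, q]" "u' @ U2" p q] v pU W M pq by simp
    next
      assume "a \<in> set F"
      then have "q \<notin> set U1" using dj a(1) by (auto simp: U1_def set_flat_comp wf1)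
      then show ?thesis
        using subseq_four_runs[of v "U1 @ u" "[q, q]" u' U2 q p] v pU W M pq by (simp add: insert_commute)
    qed
  qed
qed

text \<open>Two outer symbols alternate as in \<open>flat Y\<close>, two of one copy as in
  \<open>dflat Z\<close>. All other pairs, also those from different copies, fall under
  \<open>comp_mixed_alternation\<close>.\<close>

lemma avoids_comp:
  assumes wf: "wf_blks (nspec Z) Y" and Y: "avoids (flat Y)" and Z: "avoids (dflat Z)"
  shows "avoids (dflat (comp_blks Z 0 Y))"
  unfolding avoids_def
proof (intro allI impI notI)
  fix x y assume xy: "x \<noteq> y" and s: "subseq [x, y, x, y, x] (dflat (comp_blks Z 0 Y))"
  consider "fst x = 0" "fst y = 0" | k where "fst x = Suc k" "fst y = Suc k"
    | k where "fst x = Suc k" "fst y \<noteq> Suc k" | k where "fst y = Suc k" "fst x \<noteq> Suc k"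
    by (metis not0_implies_Suc)
  then show False
  proof cases
    case 1
    have "subseq [x, y, x, y, x] (filter (\<lambda>p. fst p = 0) (dflat (comp_blks Z 0 Y)))"
      using subseq_filter[OF s, of "\<lambda>p. fst p = 0"] 1 by simp
    then have "subseq [x, y, x, y, x] (map (Pair 0) (flat Y))"
      unfolding filter_comp_outer[OF wf] by (rule subseq_comp_outer) (use xy in auto)
    then show False using avoids_map[OF inj_Pair Y] xy avoids_def by metis
  next
    case (2 k)
    have "subseq [x, y, x, y, x] (filter (\<lambda>p. fst p = Suc k) (dflat (comp_blks Z 0 Y)))"
      using subseq_filter[OF s, of "\<lambda>p. fst p = Suc k"] 2 by simp
    then have "subseq [x, y, x, y, x] (map (Pair (Suc k)) (dflat Z))"
      unfolding filter_comp_copy by (auto split: if_splits)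
    then show False using avoids_map[OF inj_Pair Z] xy avoids_def by metis
  next
    case (3 k)
    then show False using comp_mixed_alternation[OF wf 3 s] xy by simp
  next
    case (4 k)
    then show False using comp_mixed_alternation[OF wf 4 s] xy by simp
  qed
qed

subsection \<open>Existence of the arrangements\<close>

text \<open>\<open>spec_count d m\<close> is the number of special blocks at level \<open>d\<close>. The value at \<open>m = 0\<close> is free, since
  empty blocks hold no symbols; \<open>2 ^ d\<close> makes the entries lost where equal symbols become
  adjacent sum up to \<open>O(n)\<close> over all levels.\<close>

fun spec_count :: "nat \<Rightarrow> nat \<Rightarrow> nat" where
  "spec_count 0 m = 2"
| "spec_count (Suc d) 0 = 2 ^ Suc d"
| "spec_count (Suc d) (Suc m) = spec_count (Suc d) m * spec_count d (spec_count (Suc d) m)"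

lemma spec_count_pos: "spec_count d m > 0"
  by (induction d m rule: spec_count.induct) auto

text \<open>Outer sequences are built only for block lengths from \<open>2 ^ Suc d\<close> on, and
  the block length needed is a value of \<open>spec_count (Suc d)\<close>.\<close>

lemma spec_count_ge: "2 ^ Suc d \<le> spec_count (Suc d) m"
proof (induction m)
  case (Suc m)
  have "spec_count (Suc d) m * 1 \<le> spec_count (Suc d) m * spec_count d (spec_count (Suc d) m)"
    using spec_count_pos[of d "spec_count (Suc d) m"] by (intro mult_le_mono) auto
  then show ?case using Suc by (simp only: spec_count.simps mult_1_right)
qed simp

text \<open>\<open>d\<close> is half the number of occurrences of a symbol, and \<open>m * f\<close> twice the number of symbols.\<close>

definition arrangement :: "nat \<Rightarrow> real \<Rightarrow> nat \<Rightarrow> nat \<Rightarrow> 'a blk list \<Rightarrow> bool" where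
  "arrangement d c m f Z \<longleftrightarrow> wf_blks m Z \<and> nspec Z = f \<and> 2 * card (set (flat Z)) = m * f \<and>
     length (flat Z) = d * (m * f) \<and> real (nreg Z) \<le> c * real (m * f)"

lemma arrangement_map:
  assumes "inj h" "arrangement d c m f Z"
  shows "arrangement d c m f (map (map_blk h) Z)"
  using assms by (auto simp: arrangement_def wf_blks_map card_image inj_on_subset)

text \<open>The counts are linear in \<open>m * f\<close>, and \<open>Suc m * (f * g)\<close> splits
  into \<open>f * g\<close> for \<open>Y\<close> and \<open>g * (m * f)\<close> for the
  \<open>g\<close> copies of \<open>Z\<close>; hence \<open>d\<close> and \<open>c\<close> do not
  change.\<close>

lemma arrangement_comp:
  assumes Z: "arrangement d c m f Z" and Y: "arrangement d c f g Y"
  shows "arrangement d c (Suc m) (f * g) (comp_blks Z 0 Y)"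
proof -
  have f: "nspec Z = f" "nspec Y = g" and wf: "wf_blks (nspec Z) Y" using assms by (auto simp: arrangement_def)
  have "card (set (flat (comp_blks Z 0 Y))) = card (set (flat Y)) + g * card (set (flat Z))"
    unfolding set_flat_comp[OF wf] f
    by (subst card_Un_disjoint) (auto simp: card_image card_cartesian_product inj_on_def)
  then have "2 * card (set (flat (comp_blks Z 0 Y))) = 2 * card (set (flat Y)) + g * (2 * card (set (flat Z)))"
    by simp
  also have "\<dots> = Suc m * (f * g)" using assms by (simp add: arrangement_def algebra_simps)
  finally have 1: "2 * card (set (flat (comp_blks Z 0 Y))) = Suc m * (f * g)" .
  have "real (nreg (comp_blks Z 0 Y)) = real (nreg Y) + real g * real (nreg Z)" by (simp add: f)
  also have "\<dots> \<le> c * real (f * g) + real g * (c * real (m * f))"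
    using assms by (intro add_mono mult_left_mono) (auto simp: arrangement_def)
  also have "\<dots> = c * real (Suc m * (f * g))" by (simp add: algebra_simps)
  finally have 2: "real (nreg (comp_blks Z 0 Y)) \<le> c * real (Suc m * (f * g))" .
  have 3: "length (flat (comp_blks Z 0 Y)) = d * (Suc m * (f * g))"
    using assms by (simp add: length_flat_comp[OF wf] arrangement_def algebra_simps)
  have "wf_blks (Suc m) (comp_blks Z 0 Y)" using Z wf by (intro wf_blks_comp) (auto simp: arrangement_def)
  then show ?thesis using 1 2 3 unfolding arrangement_def by (simp add: f)
qed

lemma length_dflat: "wf_blks m Z \<Longrightarrow> length (dflat Z) = length (flat Z) + m * nspec Z"
proof (induction Z)
  case (Cons b Z)
  then show ?case by (cases b) auto
qed simp

text \<open>Every symbol lies in special blocks twice and so gains two occurrences. The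
  \<open>2 * f\<close> new regular blocks are at most \<open>m * f / 2 ^ Suc d\<close>, by which the
  constant grows.\<close>

lemma arrangement_dbl:
  assumes Z: "arrangement (Suc d) (1 - 1 / 2 ^ d) m f Z" and m: "2 ^ Suc (Suc d) \<le> m"
  shows "arrangement (Suc (Suc d)) (1 - 1 / 2 ^ Suc d) m f (dbl Z)"
proof -
  have "real (2 ^ Suc (Suc d)) \<le> real m" using m by (rule of_nat_mono)
  then have "2 \<le> real m / 2 ^ Suc d" by (simp add: field_simps)
  then have "2 * real f \<le> real m / 2 ^ Suc d * real f" by (intro mult_right_mono) auto
  then have "real (nreg (dbl Z)) \<le> (1 - 1 / 2 ^ Suc d) * real (m * f)"
    using Z by (simp add: arrangement_def field_simps)
  then show ?thesis
    using Z wf_blks_dbl[of m Z] length_dflat[of m Z] by (auto simp: arrangement_def)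
qed

text \<open>The forbidden alternation begins and ends with the same symbol, so it cannot straddle
  disjoint alphabets.\<close>

lemma avoids_append:
  assumes "avoids u" "avoids v" "set u \<inter> set v = {}"
  shows "avoids (u @ v)"
  unfolding avoids_def
proof (intro allI impI notI)
  fix x y assume xy: "x \<noteq> y" and s: "subseq [x, y, x, y, x] (u @ v)"
  from s obtain p q where pq: "[x, y, x, y, x] = p @ q" "subseq p u" "subseq q v"
    by (rule subseq_appendE)
  have sub: "set p \<subseteq> set u" "set q \<subseteq> set v"
    using pq(2,3) by (simp_all add: set_subseq)
  show False
  proof (cases "p = [] \<or> q = []")
    case True
    then show ?thesis using pq assms(1,2) xy by (auto simp: avoids_def)
  next
    case False
    then have "hd p = x" "last q = x" using pq(1) by (metis hd_append2 list.sel(1), metis last_appendR last.simps list.simps(3))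
    then show ?thesis using False sub assms(3) by (metis disjoint_iff hd_in_set last_in_set subsetD)
  qed
qed

lemma avoids_subseq:
  assumes "avoids w" "subseq v w" shows "avoids v"
  using assms unfolding avoids_def by (meson subseq_order.trans)

text \<open>The alternation needs \<open>x\<close> three times.\<close>

lemma avoids_distinct_twice:
  assumes "distinct w" shows "avoids (w @ w)"
  unfolding avoids_def
proof (intro allI impI notI)
  fix x y assume xy: "x \<noteq> y" and s: "subseq [x, y, x, y, x] (w @ w)"
  have "subseq (filter ((=) x) [x, y, x, y, x]) (filter ((=) x) (w @ w))"
    using s by (rule subseq_filter)
  then have "3 \<le> length (filter ((=) x) (w @ w))"
    using xy by (auto dest!: list_emb_length)
  also have "\<dots> = 2 * count_list w x" by (simp add: count_list_eq_length_filter)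
  also have "count_list w x \<le> 1" using assms by (induction w) auto
  finally show False by simp
qed

text \<open>Level 1 is composed from the sequence \<open>w @ w\<close>, which avoids alternations only without doubling;
  hence the two separate statements.\<close>

lemma exists_arrangement_flat_dflat:
  "(2 ^ Suc d \<le> m \<longrightarrow> (\<exists>Y :: nat blk list. arrangement (Suc d) (1 - 1 / 2 ^ d) m (spec_count d m) Y \<and> avoids (flat Y)))
   \<and> (\<exists>Z :: nat blk list. arrangement (Suc d) (1 - 1 / 2 ^ d) m (spec_count (Suc d) m) Z \<and> avoids (dflat Z))"
proof -
  have dflat: "\<exists>Z :: nat blk list. arrangement (Suc d) (1 - 1 / 2 ^ d) m (spec_count (Suc d) m) Z \<and> avoids (dflat Z)"
    if flat: "\<And>m. 2 ^ Suc d \<le> m \<Longrightarrow>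
      \<exists>Y :: nat blk list. arrangement (Suc d) (1 - 1 / 2 ^ d) m (spec_count d m) Y \<and> avoids (flat Y)" for d m
  proof (induction m)
    case 0
    have "wf_blks 0 (replicate n b)" "flat (replicate n b) = []" "dflat (replicate n b) = []"
      "nspec (replicate n b) = n" "nreg (replicate n b) = 0" if "b = Spec [] []" for n and b :: "nat blk"
      unfolding that by (induction n) (auto simp: prec_def)
    then show ?case
      by (intro exI[of _ "replicate (2 ^ Suc d) (Spec [] [])"])
         (simp add: arrangement_def avoids_def)
  next
    case (Suc m)
    define f where "f = spec_count (Suc d) m"
    obtain Z :: "nat blk list" where Z: "arrangement (Suc d) (1 - 1 / 2 ^ d) m f Z" "avoids (dflat Z)"
      using Suc by (auto simp: f_def)
    obtain Y :: "nat blk list" where Y: "arrangement (Suc d) (1 - 1 / 2 ^ d) f (spec_count d f) Y" "avoids (flat Y)"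
      using flat[of f] spec_count_ge[of d m] by (auto simp: f_def)
    have "avoids (dflat (comp_blks Z 0 Y))"
      using Z Y by (intro avoids_comp) (auto simp: arrangement_def)
    \<comment> \<open>\<open>prod_encode\<close> turns the pairs back into natural numbers, which
      keeps the induction at one type.\<close>
    then show ?case
      using arrangement_map[OF inj_prod_encode arrangement_comp[OF Z(1) Y(1)]]
        avoids_map[OF inj_prod_encode, of "dflat (comp_blks Z 0 Y)"]
      by (intro exI[of _ "map (map_blk prod_encode) (comp_blks Z 0 Y)"]) (simp add: f_def)
  qed
  have flat: "\<exists>Y :: nat blk list. arrangement (Suc d) (1 - 1 / 2 ^ d) m (spec_count d m) Y \<and> avoids (flat Y)"
    if "2 ^ Suc d \<le> m" for d m
    using that
  proof (induction d arbitrary: m)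
    case 0
    have "avoids ([0..<m] @ [0..<m])" by (intro avoids_distinct_twice) simp
    \<comment> \<open>All symbols occur first in one special block and last in the other; regular
      blocks are not allowed, as \<open>1 - 1 / 2 ^ 0\<close> is \<open>0\<close>.\<close>
    then show ?case
      by (intro exI[of _ "[Spec [] [0..<m], Spec [0..<m] []]"]) (auto simp: arrangement_def prec_def)
  next
    case (Suc d)
    obtain Z :: "nat blk list" where
      "arrangement (Suc d) (1 - 1 / 2 ^ d) m (spec_count (Suc d) m) Z" "avoids (dflat Z)"
      using dflat[OF Suc.IH, of m] by auto
    \<comment> \<open>Since \<open>flat (dbl Z)\<close> is \<open>dflat Z\<close>, an arrangement
      that tolerates doubling gives the outer sequence of the next level.\<close>
    then show ?case using arrangement_dbl Suc.prems by (intro exI[of _ "dbl Z"]) auto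
  qed
  show ?thesis using flat dflat[OF flat] by blast
qed

subsection \<open>Davenport--Schinzel sequences of order 3\<close>

lemma davenport_schinzel_3: "davenport_schinzel 3 u \<longleftrightarrow> distinct_adj u \<and> avoids u"
proof -
  have "alternation a b (3 + 2) = [a, b, a, b, a]" for a b :: 'a
    by (simp add: alternation_def upt_rec)
  then show ?thesis unfolding davenport_schinzel_def avoids_def by auto
qed

lemma subseq_remdups_adj: "subseq (remdups_adj w) w"
  by (induction w rule: remdups_adj.induct) auto

lemma length_remdups_adj_append:
  "distinct u \<Longrightarrow> length u + length (remdups_adj v) \<le> length (remdups_adj (u @ v)) + 1"
proof (induction u rule: remdups_adj.induct)
  case (2 x)
  then show ?case by (cases v) auto
qed auto

text \<open>Blocks are distinct, so equal neighbours meet only at the seams, and each seam costs at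
  most one entry.\<close>

lemma length_flat_le_remdups_adj:
  "wf_blks m Z \<Longrightarrow> length (flat Z) \<le> length (remdups_adj (flat Z)) + nspec Z + nreg Z"
proof (induction Z)
  case (Cons b Z)
  have "nspec (b # Z) + nreg (b # Z) = Suc (nspec Z + nreg Z)" by (cases b) auto
  then show ?case
    using Cons length_remdups_adj_append[of "cont b" "flat Z"] by auto
qed simp

lemma ds_lambda_ge:
  fixes u :: "nat list"
  assumes "davenport_schinzel s u" shows "length u \<le> ds_lambda s (card (set u))"
  unfolding ds_lambda_def using assms by (intro Max_ge finite_ds_lengths) auto

lemma ds_lambda_3_attained:
  "\<exists>u :: nat list. davenport_schinzel 3 u \<and> card (set u) = n \<and> length u = ds_lambda 3 n"
proof -
  have "avoids (w @ [])" if "distinct w" for w :: "nat list"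
    using avoids_distinct_twice[OF that] by (rule avoids_subseq) (simp add: subseq_drop_many)
  then have "davenport_schinzel 3 [0..<n]"
    by (simp add: davenport_schinzel_3 distinct_adj_conv_nth)
  then have "length [0..<n] \<in> {length u | u :: nat list. davenport_schinzel 3 u \<and> card (set u) = n}"
    by (intro CollectI exI[of _ "[0..<n]"]) simp
  then have "ds_lambda 3 n \<in> {length u | u :: nat list. davenport_schinzel 3 u \<and> card (set u) = n}"
    unfolding ds_lambda_def by (intro Max_in finite_ds_lengths) blast
  then show ?thesis by auto
qed

text \<open>Concatenate extremal sequences, one moved to the even numbers and one to the odd
  numbers.\<close>

lemma ds_lambda_3_superadditive: "ds_lambda 3 a + ds_lambda 3 b \<le> ds_lambda 3 (a + b)"
proof -
  obtain u v :: "nat list" where u: "davenport_schinzel 3 u" "card (set u) = a" "length u = ds_lambda 3 a"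
    and v: "davenport_schinzel 3 v" "card (set v) = b" "length v = ds_lambda 3 b"
    using ds_lambda_3_attained by metis
  define f g :: "nat \<Rightarrow> nat" where "f = (\<lambda>x. 2 * x)" and "g = (\<lambda>x. 2 * x + 1)"
  have inj: "inj f" "inj g" by (auto simp: f_def g_def inj_def)
  have fg: "f x \<noteq> g y" for x y unfolding f_def g_def by presburger
  have disj: "set (map f u) \<inter> set (map g v) = {}" using fg by auto
  have "distinct_adj (map f u)" "distinct_adj (map g v)"
    using u v inj by (auto simp: davenport_schinzel_3 distinct_adj_map_iff inj_on_subset)
  then have "distinct_adj (map f u @ map g v)"
    using disj by (auto simp: distinct_adj_append_iff last_map hd_map fg)
  moreover have "avoids (map f u @ map g v)"
    using u v inj disj by (intro avoids_append avoids_map) (auto simp: davenport_schinzel_3)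
  ultimately have "length (map f u @ map g v) \<le> ds_lambda 3 (card (set (map f u @ map g v)))"
    by (intro ds_lambda_ge) (simp add: davenport_schinzel_3)
  moreover have "card (set (map f u @ map g v)) = a + b"
    using u v inj disj by (simp add: card_Un_disjoint card_image inj_on_subset)
  ultimately show ?thesis using u v by simp
qed

lemma ds_lambda_3_mult: "q * ds_lambda 3 a \<le> ds_lambda 3 (q * a + r)"
proof (induction q)
  case (Suc q)
  then show ?case using ds_lambda_3_superadditive[of a "q * a + r"] by (simp add: add.assoc)
qed simp

text \<open>Block length 1 gives \<open>f = 2 * n\<close> special blocks and
  \<open>Suc d * f\<close> entries; the seams cost at most \<open>f\<close> for the special and
  \<open>f\<close> for the regular blocks.\<close>

lemma exists_dense_ds_3:
  "\<exists>n. 2 * n = spec_count (Suc d) 1 \<and> (real d - 1) * (2 * real n) \<le> real (ds_lambda 3 n)"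
proof -
  define f where "f = spec_count (Suc d) 1"
  obtain Z :: "nat blk list" where Z: "arrangement (Suc d) (1 - 1 / 2 ^ d) 1 f Z" "avoids (dflat Z)"
    using exists_arrangement_flat_dflat[of d 1] by (auto simp: f_def)
  define u where "u = remdups_adj (flat Z)"
  have "subseq (flat Z) (dflat Z)" 
  proof (induction Z)
    case (Cons b Z)
    have "subseq (cont b) (dcont b)" 
    proof (cases b)
      case (Spec L F)
      have "subseq (L @ F) ((L @ F) @ rev F)" by (rule subseq_rev_drop_many) simp
      then show ?thesis by (simp add: Spec subseq_drop_many)
    qed simp
    then show ?case using Cons by (simp add: list_emb_append_mono)
  qed simp
  then have "avoids u"
    using Z(2) subseq_remdups_adj avoids_subseq unfolding u_def by metis
  then have ds: "davenport_schinzel 3 u" by (simp add: davenport_schinzel_3 u_def)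
  have "real (nreg Z) \<le> (1 - 1 / 2 ^ d) * real f" using Z by (simp add: arrangement_def)
  also have "\<dots> \<le> 1 * real f" by (intro mult_right_mono) auto
  finally have "nreg Z \<le> f" by simp
  then have "Suc d * f \<le> length u + f + f"
    using Z length_flat_le_remdups_adj[of 1 Z] by (simp add: arrangement_def u_def)
  also have "length u \<le> ds_lambda 3 (card (set u))" using ds by (rule ds_lambda_ge)
  finally have "Suc d * f \<le> ds_lambda 3 (card (set u)) + f + f" by simp
  then have "real (Suc d * f) \<le> real (ds_lambda 3 (card (set u)) + f + f)" by (rule of_nat_mono)
  moreover have "2 * card (set u) = f" using Z by (simp add: u_def arrangement_def)
  moreover from this have "2 * real (card (set u)) = real f" by simp
  ultimately show ?thesis
    by (intro exI[of _ "card (set u)"]) (auto simp: f_def algebra_simps)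
qed

subsection \<open>Growth\<close>

text \<open>The hierarchy inverse to \<open>alpha_hier\<close>, with the index shifted by one:
  doubling undoes the rounded halving.\<close>

fun ack :: "nat \<Rightarrow> nat \<Rightarrow> nat" where
  "ack 0 t = 2 * t"
| "ack (Suc j) 0 = 1"
| "ack (Suc j) (Suc t) = ack j (ack (Suc j) t)"

lemma alpha_hier_le_ack: "x \<le> ack j t \<Longrightarrow> alpha_hier (Suc j) x \<le> t"
proof (induction j t arbitrary: x rule: ack.induct)
  case (1 t)
  then show ?case by (subst alpha_hier.simps) (simp add: nat_ceiling_half)
next
  case (2 j)
  then show ?case by (subst alpha_hier.simps) simp
next
  case (3 j t)
  then have "alpha_hier (Suc (Suc j)) (alpha_hier (Suc j) x) \<le> t" by simp
  then show ?case by (subst alpha_hier.simps) simp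
qed

lemma ack_ge_double: "2 * t \<le> ack j t"
proof (induction j t rule: ack.induct)
  case (3 j t)
  then show ?case by (cases t) auto
qed auto

lemma ack_Suc_double: "2 * ack (Suc j) t \<le> ack (Suc j) (Suc t)"
  using ack_ge_double by simp

lemma ack_mono: "t \<le> t' \<Longrightarrow> ack j t \<le> ack j t'"
proof (induction t' rule: dec_induct)
  case (step t')
  have "ack j t' \<le> ack j (Suc t')"
    using ack_Suc_double[of _ t'] by (cases j) (simp, metis add_leD1 mult_2)
  then show ?case using step by simp
qed simp

text \<open>Moves factors into the argument, as each unit of it at least doubles the value.\<close>

lemma power_mult_ack_le: "2 ^ y * ack (Suc j) t \<le> ack (Suc j) (t + y)"
proof (induction y)
  case (Suc y)
  then show ?case using ack_Suc_double[of j "t + y"] by (simp del: ack.simps)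
qed simp

lemma power_le_ack: "2 ^ t \<le> ack (Suc j) t"
  using power_mult_ack_le[of t j 0] by simp

text \<open>At 1 and 2 the level is irrelevant; the threshold 3 of \<open>inverse_ackermann\<close>
  is the first argument where the values are unbounded in \<open>j\<close>.\<close>

lemma ack_1_2: "ack j (Suc 0) = 2" "ack j (Suc (Suc 0)) = 4"
  by (induction j) (auto simp: numeral_2_eq_2)

lemma ack_Suc_3: "ack (Suc j) 3 = ack j 4"
  by (simp add: numeral_3_eq_3 ack_1_2 del: One_nat_def)

lemma ack_3_ge: "2 ^ (j + 3) \<le> ack (Suc j) 3"
proof (induction j)
  case (Suc j)
  have "2 * ack (Suc j) 3 \<le> ack (Suc j) 4" using ack_Suc_double[of j 3] by simp
  then show ?case using Suc by (simp add: ack_Suc_3[of "Suc j"] power_add)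
qed (simp add: ack_Suc_3)

lemma power_ge_affine: "8 \<le> x \<Longrightarrow> 3 * x + 3 \<le> (2 :: nat) ^ x"
  by (induction x rule: dec_induct) auto

text \<open>A unit of \<open>m\<close> costs two units of the argument: one application of
  \<open>ack (Suc d)\<close> lifts \<open>X\<close> above \<open>3 * X + 3\<close>, which absorbs
  the factor \<open>f\<close> and the \<open>2 * f + 3\<close>, and the other carries out the
  recursion.\<close>

lemma spec_count_le_ack: "spec_count d m \<le> ack (Suc d) (2 * m + 3)"
proof (induction d m rule: spec_count.induct)
  case (1 m)
  then show ?case using ack_ge_double[of "2 * m + 3" "Suc 0"] by simp
next
  case (2 d)
  have "(2 :: nat) ^ Suc d \<le> 2 ^ (Suc d + 3)" by (intro power_increasing) auto
  then show ?case using ack_3_ge[of "Suc d"] by simp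
next
  case (3 d m)
  define f X where "f = spec_count (Suc d) m" and "X = ack (Suc (Suc d)) (2 * m + 3)"
  have fX: "f \<le> X" using 3 by (simp add: f_def X_def)
  have "8 \<le> (2 :: nat) ^ (Suc d + 3)" by (simp add: power_add)
  also have "\<dots> \<le> ack (Suc (Suc d)) 3" by (rule ack_3_ge)
  also have "\<dots> \<le> X" unfolding X_def by (rule ack_mono) simp
  finally have "3 * X + 3 \<le> 2 ^ X" by (rule power_ge_affine)
  also have "\<dots> \<le> ack (Suc d) X" by (rule power_le_ack)
  finally have X3: "3 * X + 3 \<le> ack (Suc d) X" .
  have "spec_count (Suc d) (Suc m) = f * spec_count d f" by (simp add: f_def)
  also have "\<dots> \<le> 2 ^ X * ack (Suc d) (2 * X + 3)"
  proof (rule mult_le_mono)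
    show "f \<le> 2 ^ X" using fX less_exp[of X] by linarith
    have "spec_count d f \<le> ack (Suc d) (2 * f + 3)" using 3 by (simp add: f_def)
    also have "\<dots> \<le> ack (Suc d) (2 * X + 3)" using fX by (intro ack_mono) simp
    finally show "spec_count d f \<le> ack (Suc d) (2 * X + 3)" .
  qed
  also have "\<dots> \<le> ack (Suc d) (3 * X + 3)"
    using power_mult_ack_le[of X d "2 * X + 3"] by (simp add: algebra_simps)
  also have "\<dots> \<le> ack (Suc d) (ack (Suc d) X)" using X3 by (rule ack_mono)
  also have "\<dots> = ack (Suc (Suc d)) (Suc (Suc (2 * m + 3)))" by (simp only: X_def ack.simps)
  also have "Suc (Suc (2 * m + 3)) = 2 * Suc m + 3" by simp
  finally show ?case .
qed

lemma power_ge_add: "d + 11 \<le> (2 :: nat) ^ (d + 5)"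
  by (induction d) (auto simp: power_add)

text \<open>Two more levels pay for the argument 5 and for \<open>2 ^ (d + 6)\<close>, which becomes
  \<open>2 ^ k\<close> in the theorem.\<close>

lemma spec_count_1_small: "2 ^ (d + 6) * spec_count (Suc d) 1 \<le> ack (d + 4) 3"
proof -
  have "2 ^ (d + 6) * spec_count (Suc d) 1 \<le> 2 ^ (d + 6) * ack (Suc (Suc d)) 5"
    using spec_count_le_ack[of "Suc d" 1] by (intro mult_le_mono) auto
  also have "\<dots> \<le> ack (Suc (Suc d)) (5 + (d + 6))" by (rule power_mult_ack_le)
  also have "\<dots> \<le> ack (Suc (Suc d)) (ack (Suc (Suc (Suc d))) 3)"
    using power_ge_add[of d] ack_3_ge[of "Suc (Suc d)"] by (intro ack_mono) (simp add: power_add)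
  also have "\<dots> = ack (Suc (Suc (Suc d))) 4" by (simp add: numeral_eq_Suc)
  also have "\<dots> = ack (d + 4) 3" using ack_Suc_3[of "Suc (Suc (Suc d))"] by (simp add: numeral_eq_Suc)
  finally show ?thesis .
qed

section \<open>The lower bound for all numbers of symbols\<close>

lemma less_inverse_ackermann:
  assumes "inverse_ackermann n = Suc (Suc j)" shows "ack j 3 < n"
proof (rule ccontr)
  assume "\<not> ack j 3 < n"
  \<comment> \<open>\<open>ack j\<close> belongs to \<open>alpha_hier (Suc j)\<close>, whose index
    is one below the minimum.\<close>
  then have "Suc j \<ge> 1 \<and> alpha_hier (Suc j) n \<le> 3" by (simp add: alpha_hier_le_ack)
  then have "inverse_ackermann n \<le> Suc j" unfolding inverse_ackermann_def by (rule Least_le)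
  then show False using assms by simp
qed

theorem theorem1p6:
  "\<exists>C :: real. \<forall>n :: nat.
     real (ds_lambda 3 n) \<ge> 2 * real n * real (inverse_ackermann n) - C * real n"
proof (intro exI[of _ 16] allI)
  fix n :: nat
  define k where "k = inverse_ackermann n"
  have "2 * real n * real k - 16 * real n \<le> real (ds_lambda 3 n)"
  proof (cases "k < 8")
    case True
    then have "(2 * real k - 16) * real n \<le> 0" by (intro mult_nonpos_nonneg) auto
    then show ?thesis by (simp add: algebra_simps)
  next
    case False
    \<comment> \<open>With this shift \<open>spec_count_1_small\<close> and
      \<open>less_inverse_ackermann\<close> meet at \<open>ack (d + 4) 3\<close>.\<close>
    then obtain d where d: "k = d + 6" "d \<ge> 2" by (intro that[of "k - 6"]) auto
    obtain a where a: "2 * a = spec_count (Suc d) 1" "(real d - 1) * (2 * real a) \<le> real (ds_lambda 3 a)"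
      using exists_dense_ds_3 by blast
    have "k * a \<le> 2 ^ k * (2 * a)" using less_exp[of k] by (intro mult_le_mono) auto
    also have "\<dots> \<le> ack (d + 4) 3" using spec_count_1_small[of d] unfolding a(1) d(1) .
    also have "\<dots> < n" using d by (intro less_inverse_ackermann) (simp add: k_def)
    finally have ka: "k * a \<le> n" by simp
    have a0: "a > 0" using a(1) spec_count_pos[of "Suc d" 1] by simp
    \<comment> \<open>The \<open>n\<close> symbols form \<open>q\<close> groups of \<open>a\<close>.
      The \<open>r < a\<close> left over cost little, because \<open>k * a \<le> n\<close>.\<close>
    define q r where "q = n div a" and "r = n mod a"
    have n: "n = q * a + r" and r: "r < a" using a0 by (auto simp: q_def r_def)
    have "real d * real r \<le> real k * real a" using r d by (intro mult_mono) auto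
    also have "\<dots> \<le> real n" using of_nat_mono[OF ka, where 'a = real] by simp
    finally have dr: "real d * real r \<le> real n" .
    \<comment> \<open>The 16 is 12 from \<open>k = d + 6\<close>, 2 from the \<open>d - 1\<close> in
      the dense bound and 2 for the \<open>r\<close> symbols left over.\<close>
    have "2 * real n * real k - 16 * real n \<le> 2 * (real d - 1) * real n - 2 * real n"
      by (simp add: d algebra_simps)
    also have "\<dots> \<le> 2 * (real d - 1) * (real n - real r)" using dr by (simp add: algebra_simps)
    also have "\<dots> = real q * ((real d - 1) * (2 * real a))" by (simp add: n algebra_simps)
    also have "\<dots> \<le> real q * real (ds_lambda 3 a)" using a by (intro mult_left_mono) auto
    also have "\<dots> \<le> real (ds_lambda 3 n)"
      using of_nat_mono[OF ds_lambda_3_mult[of q a r], where 'a = real] by (simp add: n)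
    finally show ?thesis .
  qed
  then show "2 * real n * real (inverse_ackermann n) - 16 * real n \<le> real (ds_lambda 3 n)"
    by (simp add: k_def)
qed

end
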